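(* Let $d\ge1$ be an integer and consider $N=d+1$ bodies with positive masses $m_1,\dots,m_{d+1}$ moving in $\mathbb{R}^d$ according to Newton's equations $m_a\ddot q_a=-\partial V/\partial q_a$ with potential $$V(q)=G\sum_{\{a,b\},\,a\neq b}m_am_b\,f_{ab}(r_{ab}(q)),$$ the sum being over unordered pairs, where the functions $f_{ab}:(0,\infty)\to\mathbb{R}$ satisfy $$f_{ab}'(r)>0,\qquad f_{ab}''(r)<0\quad\text{for all } r>0,\qquad \lim_{r\to\infty}\frac{f_{ab}'(r)}{r}=0 .$$ Let $q: I\to(\mathbb{R}^d)^{d+1}$ be a zero angular momentum solution on an interval $I\subset\mathbb{R}$ and suppose there is $c>0$ with $r_{ab}(t)\le c$ for all pairs $a\ne b$ and all $t\in I$. Put $\delta=\min_{a\neq b} \frac{f_{ab}'(c)}{c}>0$. Then every closed time interval contained in $I$ of length $\pi\,(GM\delta)^{-1/2}$ contains a degeneration instant of the solution.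
   Context: $G>0$ is a constant, $M=\sum_a m_a$ is the total mass, and $r_{ab}=|q_a-q_b|$. The functions $f_{ab}=f_{ba}$ are assumed twice continuously differentiable. A solution on $I$ is a curve satisfying Newton's equations and having all $r_{ab}(t)>0$ for $t\in I$. Angular momentum is taken in the center-of-mass frame: with $q_{cm}=\frac1M\sum_a m_aq_a$, zero angular momentum means $\sum_a m_a(q_a-q_{cm})\wedge(\dot q_a-\dot q_{cm})=0$. A degeneration instant is a time $t$ at which all $d+1$ points $q_1(t),\dots,q_{d+1}(t)$ lie on a single affine hyperplane of $\mathbb{R}^d$. *)

theory Defs
  imports "HOL-Analysis.Analysis"
begin

text \<open>
  A configuration of \<open>N\<close> bodies is a map \<open>q :: nat \<Rightarrow> real ^ 'd\<close> of which only the values on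
  the index set \<open>{1..N}\<close> matter; likewise for the masses \<open>m a\<close>. Unordered pairs of bodies are
  represented by index pairs \<open>a < b\<close>. The functions \<open>f a b\<close> are total, but only their values on
  the positive reals matter.
\<close>

definition potential ::
  "nat \<Rightarrow> real \<Rightarrow> (nat \<Rightarrow> real) \<Rightarrow> (nat \<Rightarrow> nat \<Rightarrow> real \<Rightarrow> real) \<Rightarrow> (nat \<Rightarrow> real ^ 'd) \<Rightarrow> real" where
  "potential N G m f q =
     G * (\<Sum>(a, b) \<in> {(a, b). a \<in> {1..N} \<and> b \<in> {1..N} \<and> a < b}.
            m a * m b * f a b (dist (q a) (q b)))"

definition twice_cont_diff_on_pos :: "(real \<Rightarrow> real) \<Rightarrow> bool" where
  "twice_cont_diff_on_pos g \<longleftrightarrow>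
     (\<forall>r>0. g differentiable (at r)) \<and>
     (\<forall>r>0. deriv g differentiable (at r)) \<and>
     continuous_on {0<..} (deriv (deriv g))"

text \<open>
  A collision-free solution of Newton's equations on \<open>I\<close>, with velocities \<open>v\<close>. Derivatives in time
  are taken within \<open>I\<close>, hence are one-sided at end points belonging to \<open>I\<close>. The partial gradient
  of the potential with respect to the position of body \<open>a\<close> is the gradient of the
  potential as a function of that position alone; the last conjunct says that it equals
  \<open>- m a\<close> times the acceleration.
\<close>

definition newton_solution ::
  "nat \<Rightarrow> real \<Rightarrow> (nat \<Rightarrow> real) \<Rightarrow> (nat \<Rightarrow> nat \<Rightarrow> real \<Rightarrow> real) \<Rightarrow> real set \<Rightarrow>
   (real \<Rightarrow> nat \<Rightarrow> real ^ 'd) \<Rightarrow> (real \<Rightarrow> nat \<Rightarrow> real ^ 'd) \<Rightarrow> bool" where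
  "newton_solution N G m f I q v \<longleftrightarrow>
     (\<forall>t\<in>I. \<forall>a\<in>{1..N}. \<forall>b\<in>{1..N}. a \<noteq> b \<longrightarrow> dist (q t a) (q t b) > 0) \<and>
     (\<forall>t\<in>I. \<forall>a\<in>{1..N}.
        ((\<lambda>s. q s a) has_vector_derivative v t a) (at t within I) \<and>
        (\<exists>acc. ((\<lambda>s. v s a) has_vector_derivative acc) (at t within I) \<and>
               GDERIV (\<lambda>x. potential N G m f ((q t)(a := x))) (q t a) :> - (m a *\<^sub>R acc)))"

text \<open>A bivector is represented by its antisymmetric coordinate matrix.\<close>

definition wedge :: "real ^ 'd \<Rightarrow> real ^ 'd \<Rightarrow> real ^ 'd ^ 'd" where
  "wedge u w = (\<chi> i j. u $ i * w $ j - u $ j * w $ i)"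

text \<open>Applied to the velocities, this is the velocity of the centre of mass.\<close>

definition mass_average :: "nat \<Rightarrow> (nat \<Rightarrow> real) \<Rightarrow> (nat \<Rightarrow> real ^ 'd) \<Rightarrow> real ^ 'd" where
  "mass_average N m x = (1 / (\<Sum>a\<in>{1..N}. m a)) *\<^sub>R (\<Sum>a\<in>{1..N}. m a *\<^sub>R x a)"

definition angular_momentum ::
  "nat \<Rightarrow> (nat \<Rightarrow> real) \<Rightarrow> (nat \<Rightarrow> real ^ 'd) \<Rightarrow> (nat \<Rightarrow> real ^ 'd) \<Rightarrow> real ^ 'd ^ 'd" where
  "angular_momentum N m x v =
     (\<Sum>a\<in>{1..N}. m a *\<^sub>R wedge (x a - mass_average N m x) (v a - mass_average N m v))"

definition degenerate :: "nat \<Rightarrow> (nat \<Rightarrow> real ^ 'd) \<Rightarrow> bool" where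
  "degenerate N x \<longleftrightarrow> (\<exists>n \<beta>. n \<noteq> 0 \<and> (\<forall>a\<in>{1..N}. x a \<in> {y. n \<bullet> y = \<beta>}))"

end

theory Submission
  imports Defs
begin

text \<open>
  In the centre-of-mass frame, with positions \<open>x\<^sub>a\<close> and velocities \<open>y\<^sub>a\<close>, let
  \<open>Q(t, w) = (\<Sum>a. m\<^sub>a (w \<bullet> x\<^sub>a(t))\<^sup>2)\<close>. The configuration is degenerate exactly when \<open>Q(t, \<cdot>)\<close> has a nonzero
  null vector, and the square root \<open>\<sigma>(t)\<close> of the minimum of \<open>Q(t, \<cdot>)\<close> over unit vectors is the distance
  from the degenerate configurations in the mass metric. The theorem holds because, away from degeneration,
  \<open>\<sigma>'' \<le> - \<omega>\<^sup>2 \<sigma>\<close> with \<open>\<omega>\<^sup>2 = G M \<delta>\<close>, so that \<open>\<sigma>\<close> vanishes at least once in every half period \<open>\<pi> / \<omega>\<close>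
  of the harmonic oscillator, by Sturm comparison.

  Since \<open>\<sigma>\<close> need not be differentiable where the least singular value is multiple, the inequality is used
  only through a smooth barrier at one point. If there is no degeneration on \<open>[\<alpha>, \<beta>]\<close>, compare \<open>\<sigma>\<close> with
  \<open>h(t) = cos (\<theta> (t - (\<alpha> + \<beta>) / 2))\<close> for some \<open>\<theta> < \<omega>\<close>: when \<open>\<theta>\<close> is close to \<open>\<omega>\<close>, \<open>h\<close> nearly vanishes at the end
  points, so \<open>Q(t, n) / h(t)\<^sup>2\<close> attains its minimum \<open>\<mu>\<close> over times and unit vectors at an interior time
  \<open>t\<^sub>0\<close>, at a vector \<open>n\<^sub>0\<close> (\<open>interior_minimum_of_cosine_quotient\<close>). For every path \<open>w\<close> of vectors through
  \<open>n\<^sub>0\<close> the function \<open>D(t) = Q(t, w(t)) - \<mu> h(t)\<^sup>2 |w(t)|\<^sup>2\<close> is nonnegative and vanishes at \<open>t\<^sub>0\<close>,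
  hence \<open>D''(t\<^sub>0) \<ge> 0\<close>.

  The contradiction comes from a good path. As \<open>d + 1\<close> bodies span \<open>\<real>\<^sup>d\<close> with only one linear relation
  between the \<open>x\<^sub>a\<close>, one can move \<open>w\<close> so that all the projections \<open>w \<bullet> x\<^sub>a\<close> are stationary at \<open>t\<^sub>0\<close>
  (\<open>nondegenerate_covector_exists\<close>). Vanishing angular momentum then makes the rotation of \<open>w\<close> contribute
  with the right sign (\<open>zero_momentum_symmetry\<close>), and the forces are at least as restoring as springs of
  frequency \<open>\<omega>\<close>, because \<open>f'(r) / r\<close> is decreasing (\<open>restoring_force\<close>). The outcome is
  \<open>D''(t\<^sub>0) \<le> 2 (\<theta>\<^sup>2 - \<omega>\<^sup>2) \<mu> h(t\<^sub>0)\<^sup>2 < 0\<close> (\<open>no_interior_minimum\<close>).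
\<close>

section \<open>One-variable calculus and linear algebra\<close>

lemma second_derivative_at_minimum:
  fixes D :: "real \<Rightarrow> real"
  assumes t0: "\<alpha> < t0" "t0 < \<beta>"
    and D: "\<And>t. \<alpha> < t \<Longrightarrow> t < \<beta> \<Longrightarrow> (D has_real_derivative D' t) (at t)"
    and D': "(D' has_real_derivative D2) (at t0)"
    and ge: "\<And>t. \<alpha> < t \<Longrightarrow> t < \<beta> \<Longrightarrow> D t0 \<le> D t"
  shows "D' t0 = 0" and "D2 \<ge> 0"
proof -
  define e where "e = min (t0 - \<alpha>) (\<beta> - t0)"
  have e: "e > 0" using t0 by (auto simp: e_def)
  show z: "D' t0 = 0"
    by (rule DERIV_local_min[OF D[OF t0] e]) (auto intro!: ge simp: e_def abs_if split: if_splits)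
  show "D2 \<ge> 0"
  proof (rule ccontr)
    assume "\<not> D2 \<ge> 0"
    then obtain k where k: "k > 0" "\<And>s. s > 0 \<Longrightarrow> s < k \<Longrightarrow> D' (t0 + s) < D' t0"
      using DERIV_neg_dec_right[OF D'] by auto
    define s where "s = min k e / 2"
    have s: "0 < s" "s < k" "s < e" using k e by (auto simp: s_def)
    have se: "t0 + s < \<beta>" using s by (auto simp: e_def)
    have "\<exists>\<xi>. t0 < \<xi> \<and> \<xi> < t0 + s \<and> D (t0 + s) - D t0 = (t0 + s - t0) * D' \<xi>"
      using s se t0 by (intro MVT2) (auto intro!: D)
    then obtain \<xi> where \<xi>: "t0 < \<xi>" "\<xi> < t0 + s" "D (t0 + s) - D t0 = s * D' \<xi>" by auto
    have "D' \<xi> < 0" using k(2)[of "\<xi> - t0"] \<xi> s z by auto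
    then have "D (t0 + s) < D t0" using \<xi> s by (smt (verit) mult_pos_neg)
    then show False using ge[of "t0 + s"] s se t0 by auto
  qed
qed

text \<open>
  The evaluation \<open>w \<mapsto> (w \<bullet> x a)\<close> at all \<open>d + 1\<close> points is injective by nondegeneracy, and its image lies in
  the \<open>d\<close>-dimensional space of tuples with weighted sum zero; so it maps onto that space. This is
  where it matters that there are exactly \<open>d + 1\<close> bodies. Concretely, the first \<open>d\<close> coordinates
  determine the last one, so it suffices to look at a square system.
\<close>

lemma nondegenerate_covector_exists:
  fixes x :: "nat \<Rightarrow> real ^ 'd"
  assumes N: "N = CARD('d) + 1"
    and m: "\<And>a. a \<in> {1..N} \<Longrightarrow> m a > 0"
    and sx: "(\<Sum>a\<in>{1..N}. m a *\<^sub>R x a) = 0"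
    and sp: "(\<Sum>a\<in>{1..N}. m a * p a) = 0"
    and nd: "\<And>w. w \<noteq> 0 \<Longrightarrow> \<exists>a\<in>{1..N}. w \<bullet> x a \<noteq> 0"
  shows "\<exists>w. \<forall>a\<in>{1..N}. w \<bullet> x a = p a"
proof -
  obtain \<phi> :: "'d \<Rightarrow> nat" where \<phi>: "bij_betw \<phi> UNIV {1..CARD('d)}"
    using finite_same_card_bij[of "UNIV :: 'd set" "{1..CARD('d)}"] by auto
  have cases: "(\<exists>i. a = \<phi> i) \<or> a = N" if "a \<in> {1..N}" for a
  proof (cases "a = N")
    case False
    then have "a \<in> {1..CARD('d)}" using that N by auto
    then show ?thesis using \<phi> by (metis bij_betw_imp_surj_on imageE)
  qed simp
  have split: "{1..N} = insert N {1..CARD('d)}" using N by auto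
  have last: "w \<bullet> x N = p' N"
    if "(\<Sum>a\<in>{1..N}. m a * p' a) = 0" "\<And>i. w \<bullet> x (\<phi> i) = p' (\<phi> i)" for w and p' :: "nat \<Rightarrow> real"
  proof -
    have eq: "a \<in> {1..CARD('d)} \<Longrightarrow> w \<bullet> x a = p' a" for a
      using that(2) \<phi> by (metis bij_betw_imp_surj_on imageE)
    have "(\<Sum>a\<in>{1..N}. m a * (w \<bullet> x a)) = w \<bullet> (\<Sum>a\<in>{1..N}. m a *\<^sub>R x a)"
      by (simp add: inner_sum_right)
    then have "(\<Sum>a\<in>{1..N}. m a * (w \<bullet> x a)) = (\<Sum>a\<in>{1..N}. m a * p' a)"
      using sx that(1) by simp
    moreover have "(\<Sum>a\<in>{1..CARD('d)}. m a * (w \<bullet> x a)) = (\<Sum>a\<in>{1..CARD('d)}. m a * p' a)"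
      using eq by (intro sum.cong) auto
    ultimately have "m N * (w \<bullet> x N) = m N * p' N"
      unfolding split using N by simp
    then show ?thesis using m[of N] N by auto
  qed
  define T where "T = (\<lambda>w::real ^ 'd. (\<chi> i. w \<bullet> x (\<phi> i)) :: real ^ 'd)"
  have lin: "linear T"
    by (rule linearI) (auto simp: T_def vec_eq_iff inner_add_left)
  have "inj T"
    unfolding linear_injective_0[OF lin]
  proof (intro allI impI, rule ccontr)
    fix w assume w: "T w = 0" "w \<noteq> 0"
    have "w \<bullet> x (\<phi> i) = 0" for i using w(1) by (auto simp: T_def vec_eq_iff)
    with last[of "\<lambda>_. 0" w] cases nd[OF w(2)] show False by fastforce
  qed
  then have "surj T" using linear_injective_imp_surjective[OF lin] by auto
  then obtain w where "T w = (\<chi> i. p (\<phi> i))" by (metis surjD)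
  then have w: "w \<bullet> x (\<phi> i) = p (\<phi> i)" for i by (auto simp: T_def vec_eq_iff)
  with last[OF sp w] cases show ?thesis by (metis (full_types))
qed

text \<open>
  Both sides are values of the bilinear form with matrix \<open>\<Sum>a. m a x\<^sub>a y\<^sub>a\<^sup>T\<close>, whose antisymmetric part is
  half the angular momentum.
\<close>

lemma zero_momentum_symmetry:
  fixes x y :: "nat \<Rightarrow> real ^ 'd"
  assumes "(\<Sum>a\<in>A. m a *\<^sub>R wedge (x a) (y a)) = 0"
  shows "(\<Sum>a\<in>A. m a * ((u \<bullet> x a) * (w \<bullet> y a))) = (\<Sum>a\<in>A. m a * ((w \<bullet> x a) * (u \<bullet> y a)))"
proof -
  have comp: "(\<Sum>a\<in>A. m a * (x a $ i * y a $ j - x a $ j * y a $ i)) = 0" for i j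
  proof -
    have "(\<Sum>a\<in>A. m a *\<^sub>R wedge (x a) (y a)) $ i $ j = 0" using assms by simp
    then show ?thesis by (simp add: wedge_def)
  qed
  have prod: "(u \<bullet> x a) * (w \<bullet> y a) = (\<Sum>i\<in>UNIV. \<Sum>j\<in>UNIV. u $ i * w $ j * (x a $ i * y a $ j))" for a
    by (simp add: inner_vec_def sum_product mult_ac)
  have prod': "(w \<bullet> x a) * (u \<bullet> y a) = (\<Sum>i\<in>UNIV. \<Sum>j\<in>UNIV. u $ i * w $ j * (x a $ j * y a $ i))" for a
    unfolding mult.commute[of "w \<bullet> x a"] by (simp add: inner_vec_def sum_product mult_ac)
  have "(\<Sum>a\<in>A. m a * ((u \<bullet> x a) * (w \<bullet> y a))) - (\<Sum>a\<in>A. m a * ((w \<bullet> x a) * (u \<bullet> y a)))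
      = (\<Sum>a\<in>A. \<Sum>i\<in>UNIV. \<Sum>j\<in>UNIV. u $ i * w $ j * (m a * (x a $ i * y a $ j - x a $ j * y a $ i)))"
    unfolding prod prod' by (simp add: sum_subtractf[symmetric] sum_distrib_left algebra_simps)
  also have "\<dots> = (\<Sum>i\<in>UNIV. \<Sum>j\<in>UNIV. u $ i * w $ j * (\<Sum>a\<in>A. m a * (x a $ i * y a $ j - x a $ j * y a $ i)))"
    by (subst sum.swap, rule sum.cong[OF refl], subst sum.swap) (simp add: sum_distrib_left)
  finally show ?thesis using comp by simp
qed

lemma pairwise_variance:
  fixes m u :: "nat \<Rightarrow> real"
  assumes "(\<Sum>a\<in>{1..N}. m a * u a) = 0"
  shows "(\<Sum>(a, b)\<in>{(a, b). a \<in> {1..N} \<and> b \<in> {1..N} \<and> a < b}. m a * m b * (u a - u b)\<^sup>2)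
    = (\<Sum>a\<in>{1..N}. m a) * (\<Sum>a\<in>{1..N}. m a * (u a)\<^sup>2)"
proof -
  let ?A = "{1..N}"
  let ?g = "\<lambda>(a, b). m a * m b * (u a - u b)\<^sup>2"
  let ?P = "{(a, b). a \<in> ?A \<and> b \<in> ?A \<and> a < b}"
  let ?P' = "{(a, b). a \<in> ?A \<and> b \<in> ?A \<and> b < a}"
  let ?E = "{(a, b). a \<in> ?A \<and> b \<in> ?A \<and> a = b}"
  have fin: "finite ?P" "finite ?P'" "finite ?E"
    by (auto intro: finite_subset[of _ "?A \<times> ?A"])
  have "?A \<times> ?A = ?P \<union> ?P' \<union> ?E" by auto
  then have "sum ?g (?A \<times> ?A) = sum ?g ?P + sum ?g ?P' + sum ?g ?E"
    using fin by (simp add: sum.union_disjoint disjoint_iff)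
  moreover have "sum ?g ?E = 0" by (rule sum.neutral) auto
  moreover have "sum ?g ?P' = sum ?g ?P"
    by (rule sum.reindex_bij_witness[of _ prod.swap prod.swap])
       (auto simp: power2_commute mult_ac)
  ultimately have "2 * sum ?g ?P = sum ?g (?A \<times> ?A)" by simp
  also have "\<dots> = (\<Sum>a\<in>?A. \<Sum>b\<in>?A. m a * m b * (u a - u b)\<^sup>2)"
    by (simp add: sum.cartesian_product)
  also have "\<dots> = (\<Sum>a\<in>?A. \<Sum>b\<in>?A. m a * (u a)\<^sup>2 * m b + m a * (m b * (u b)\<^sup>2)
      - 2 * ((m a * u a) * (m b * u b)))"
    by (intro sum.cong refl) (simp add: power2_eq_square algebra_simps)
  also have "\<dots> = 2 * ((\<Sum>a\<in>?A. m a) * (\<Sum>a\<in>?A. m a * (u a)\<^sup>2))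
      - 2 * ((\<Sum>a\<in>?A. m a * u a) * (\<Sum>b\<in>?A. m b * u b))"
    by (simp add: sum.distrib sum_subtractf sum_distrib_left[symmetric]
        sum_distrib_right[symmetric])
  finally show ?thesis using assms by simp
qed

section \<open>The forces\<close>

lemma GDERIV_radial:
  fixes p z :: "'a :: real_inner"
  assumes "z \<noteq> p" and "g differentiable (at (dist z p))"
  shows "GDERIV (\<lambda>x. g (dist x p)) z :> (deriv g (dist z p) / dist z p) *\<^sub>R (z - p)"
proof -
  have "((\<lambda>x. norm (x - p)) has_derivative (\<lambda>h. h \<bullet> sgn (z - p))) (at z)"
    using assms(1)
    by (intro has_derivative_compose[OF _ GDERIV_norm[unfolded gderiv_def]])
       (auto intro!: derivative_eq_intros)
  then have "GDERIV (\<lambda>x. dist x p) z :> sgn (z - p)"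
    by (simp add: gderiv_def dist_norm)
  moreover have "(g has_real_derivative deriv g (dist z p)) (at (dist z p))"
    using assms(2) by (simp add: DERIV_deriv_iff_real_differentiable)
  ultimately have "GDERIV (\<lambda>x. g (dist x p)) z :> deriv g (dist z p) *\<^sub>R sgn (z - p)"
    by (rule GDERIV_DERIV_compose)
  then show ?thesis by (simp add: sgn_div_norm dist_norm divide_inverse)
qed

lemma GDERIV_pair_term:
  fixes q :: "nat \<Rightarrow> real ^ 'd"
  assumes ab: "a \<noteq> b" and q: "q a \<noteq> q b"
    and g: "g differentiable (at (dist (q a) (q b)))"
  shows "GDERIV (\<lambda>x. g (dist ((q(i := x)) a) ((q(i := x)) b))) (q i) :>
    (deriv g (dist (q a) (q b)) / dist (q a) (q b) * (of_bool (i = a) - of_bool (i = b))) *\<^sub>R (q a - q b)"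
proof -
  consider "i = a" | "i = b" | "i \<noteq> a" "i \<noteq> b" by blast
  then show ?thesis
  proof cases
    case 1
    then show ?thesis using GDERIV_radial[OF q g] ab by simp
  next
    case 2
    have "(deriv g (dist (q b) (q a)) / dist (q b) (q a)) *\<^sub>R (q b - q a)
      = (deriv g (dist (q a) (q b)) / dist (q a) (q b) * - 1) *\<^sub>R (q a - q b)"
      by (simp add: dist_commute algebra_simps)
    then show ?thesis using GDERIV_radial[of "q b" "q a" g] q g ab 2
      by (simp add: dist_commute)
  next
    case 3
    then show ?thesis by (simp add: gderiv_def)
  qed
qed

text \<open>
  Reading off the accelerations from the gradient and exchanging the sum over bodies with the sum over
  pairs: in each pair the two bodies feel opposite forces along \<open>q a - q b\<close>, so only the difference
  \<open>u a - u b\<close> survives.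
\<close>

lemma work_of_forces:
  fixes q :: "nat \<Rightarrow> real ^ 'd" and acc :: "nat \<Rightarrow> real ^ 'd"
  assumes pos: "\<And>a b. a \<in> {1..N} \<Longrightarrow> b \<in> {1..N} \<Longrightarrow> a \<noteq> b \<Longrightarrow> q a \<noteq> q b"
    and diff: "\<And>a b. a \<in> {1..N} \<Longrightarrow> b \<in> {1..N} \<Longrightarrow> a \<noteq> b \<Longrightarrow>
      f a b differentiable (at (dist (q a) (q b)))"
    and newton: "\<And>i. i \<in> {1..N} \<Longrightarrow>
      GDERIV (\<lambda>x. potential N G m f (q(i := x))) (q i) :> - (m i *\<^sub>R acc i)"
  shows "(\<Sum>i\<in>{1..N}. m i * (u i * (n \<bullet> acc i))) =
    - G * (\<Sum>(a, b)\<in>{(a, b). a \<in> {1..N} \<and> b \<in> {1..N} \<and> a < b}.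
      m a * m b * (deriv (f a b) (dist (q a) (q b)) / dist (q a) (q b))
        * ((u a - u b) * (n \<bullet> q a - n \<bullet> q b)))"
proof -
  let ?P = "{(a, b). a \<in> {1..N} \<and> b \<in> {1..N} \<and> a < b}"
  define k where "k = (\<lambda>a b. m a * m b * (deriv (f a b) (dist (q a) (q b)) / dist (q a) (q b)))"
  define F where "F = (\<lambda>i. G *\<^sub>R (\<Sum>(a, b)\<in>?P.
      (k a b * (of_bool (i = a) - of_bool (i = b))) *\<^sub>R (q a - q b)))"
  have force: "m i *\<^sub>R acc i = - F i" if i: "i \<in> {1..N}" for i
  proof -
    have pair: "((\<lambda>x. m a * m b * f a b (dist ((q(i := x)) a) ((q(i := x)) b))) has_derivative
        (\<lambda>h. h \<bullet> ((k a b * (of_bool (i = a) - of_bool (i = b))) *\<^sub>R (q a - q b)))) (at (q i))"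
      if "(a, b) \<in> ?P" for a b
    proof -
      have "GDERIV (\<lambda>x. f a b (dist ((q(i := x)) a) ((q(i := x)) b))) (q i) :>
        (deriv (f a b) (dist (q a) (q b)) / dist (q a) (q b) * (of_bool (i = a) - of_bool (i = b))) *\<^sub>R (q a - q b)"
        using that by (intro GDERIV_pair_term pos diff) auto
      from has_derivative_mult_right[OF this[unfolded gderiv_def], of "m a * m b"]
      show ?thesis by (simp add: k_def mult_ac)
    qed
    have "((\<lambda>x. \<Sum>(a, b)\<in>?P. m a * m b * f a b (dist ((q(i := x)) a) ((q(i := x)) b))) has_derivative
        (\<lambda>h. \<Sum>(a, b)\<in>?P. h \<bullet> ((k a b * (of_bool (i = a) - of_bool (i = b))) *\<^sub>R (q a - q b)))) (at (q i))"
      unfolding case_prod_unfold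
      by (rule has_derivative_sum) (use pair in \<open>auto simp: case_prod_unfold\<close>)
    from has_derivative_mult_right[OF this, of G]
    have "GDERIV (\<lambda>x. potential N G m f (q(i := x))) (q i) :> F i"
      unfolding gderiv_def potential_def F_def
      by (simp add: inner_sum_right case_prod_unfold)
    from has_derivative_unique[OF this[unfolded gderiv_def] newton[OF i, unfolded gderiv_def]]
    have "\<And>h. h \<bullet> F i = h \<bullet> - (m i *\<^sub>R acc i)" by meson
    then have "F i = - (m i *\<^sub>R acc i)" by (metis vector_eq_rdot inner_commute)
    then show ?thesis by simp
  qed
  have "(\<Sum>i\<in>{1..N}. m i * (u i * (n \<bullet> acc i))) = (\<Sum>i\<in>{1..N}. u i * (n \<bullet> (m i *\<^sub>R acc i)))"
    by (simp add: mult_ac)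
  also have "\<dots> = - (\<Sum>i\<in>{1..N}. u i * (n \<bullet> F i))"
    unfolding sum_negf[symmetric] by (rule sum.cong) (simp_all only: force inner_minus_right mult_minus_right)
  also have "(\<Sum>i\<in>{1..N}. u i * (n \<bullet> F i)) =
     G * (\<Sum>i\<in>{1..N}. \<Sum>(a, b)\<in>?P. (of_bool (i = a) - of_bool (i = b)) * u i * (k a b * (n \<bullet> q a - n \<bullet> q b)))"
    by (simp add: F_def inner_sum_right sum_distrib_left case_prod_unfold inner_diff_right mult_ac)
  also have "(\<Sum>i\<in>{1..N}. \<Sum>(a, b)\<in>?P. (of_bool (i = a) - of_bool (i = b)) * u i * (k a b * (n \<bullet> q a - n \<bullet> q b)))
     = (\<Sum>(a, b)\<in>?P. \<Sum>i\<in>{1..N}. (of_bool (i = a) - of_bool (i = b)) * u i * (k a b * (n \<bullet> q a - n \<bullet> q b)))"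
    unfolding case_prod_unfold by (rule sum.swap)
  also have "\<dots> = (\<Sum>(a, b)\<in>?P. k a b * ((u a - u b) * (n \<bullet> q a - n \<bullet> q b)))"
  proof (intro sum.cong refl, clarify)
    fix a b assume ab: "a \<in> {1..N}" "b \<in> {1..N}"
    have "(\<Sum>i\<in>{1..N}. (of_bool (i = a) - of_bool (i = b)) * u i) = u a - u b"
      using ab by (simp add: left_diff_distrib sum_subtractf of_bool_def if_distrib[of "\<lambda>x. x * _"] cong: if_cong)
    then show "(\<Sum>i\<in>{1..N}. (of_bool (i = a) - of_bool (i = b)) * u i * (k a b * (n \<bullet> q a - n \<bullet> q b)))
      = k a b * ((u a - u b) * (n \<bullet> q a - n \<bullet> q b))"
      by (simp add: sum_distrib_right[symmetric])
  qed
  finally show ?thesis by (simp add: k_def)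
qed

text \<open>
  With \<open>u a = n \<bullet> x a\<close> the pair sum in \<open>work_of_forces\<close> has the squares \<open>(u a - u b)\<^sup>2\<close> with coefficients
  at least \<open>G \<delta> m a m b\<close>, and by \<open>pairwise_variance\<close> the pair sum with equality is the one of springs,
  each body being pulled to the centre of mass with strength \<open>G M \<delta>\<close> per unit mass.
\<close>

lemma restoring_force:
  fixes q x :: "nat \<Rightarrow> real ^ 'd" and acc :: "nat \<Rightarrow> real ^ 'd"
  assumes G: "G > 0" and m: "\<And>a. a \<in> {1..N} \<Longrightarrow> m a > 0"
    and pos: "\<And>a b. a \<in> {1..N} \<Longrightarrow> b \<in> {1..N} \<Longrightarrow> a \<noteq> b \<Longrightarrow> q a \<noteq> q b"
    and diff: "\<And>a b. a \<in> {1..N} \<Longrightarrow> b \<in> {1..N} \<Longrightarrow> a \<noteq> b \<Longrightarrow>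
      f a b differentiable (at (dist (q a) (q b)))"
    and newton: "\<And>i. i \<in> {1..N} \<Longrightarrow>
      GDERIV (\<lambda>x. potential N G m f (q(i := x))) (q i) :> - (m i *\<^sub>R acc i)"
    and \<delta>: "\<And>a b. a \<in> {1..N} \<Longrightarrow> b \<in> {1..N} \<Longrightarrow> a \<noteq> b \<Longrightarrow>
      \<delta> \<le> deriv (f a b) (dist (q a) (q b)) / dist (q a) (q b)"
    and x: "\<And>a. x a = q a - z" and sx: "(\<Sum>a\<in>{1..N}. m a *\<^sub>R x a) = 0"
  shows "(\<Sum>a\<in>{1..N}. m a * ((n \<bullet> x a) * (n \<bullet> acc a)))
    \<le> - (G * (\<Sum>a\<in>{1..N}. m a) * \<delta>) * (\<Sum>a\<in>{1..N}. m a * (n \<bullet> x a)\<^sup>2)"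
proof -
  let ?P = "{(a, b). a \<in> {1..N} \<and> b \<in> {1..N} \<and> a < b}"
  have rel: "n \<bullet> q a - n \<bullet> q b = n \<bullet> x a - n \<bullet> x b" for a b by (simp add: x inner_diff_right)
  have "n \<bullet> (\<Sum>a\<in>{1..N}. m a *\<^sub>R x a) = 0" using sx by simp
  then have "(\<Sum>a\<in>{1..N}. m a * (n \<bullet> x a)) = 0" by (simp add: inner_sum_right)
  note var = pairwise_variance[OF this]
  have "\<delta> * (\<Sum>(a, b)\<in>?P. m a * m b * (n \<bullet> x a - n \<bullet> x b)\<^sup>2) \<le>
    (\<Sum>(a, b)\<in>?P. m a * m b * (deriv (f a b) (dist (q a) (q b)) / dist (q a) (q b))
        * ((n \<bullet> x a - n \<bullet> x b) * (n \<bullet> q a - n \<bullet> q b)))"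
    unfolding sum_distrib_left rel
  proof (rule sum_mono, clarify)
    fix a b assume ab: "a \<in> {1..N}" "b \<in> {1..N}" "a < b"
    have "m a * m b * (n \<bullet> x a - n \<bullet> x b)\<^sup>2 \<ge> 0" using m[of a] m[of b] ab by simp
    from mult_right_mono[OF \<delta> this, of a b] ab
    show "\<delta> * (m a * m b * (n \<bullet> x a - n \<bullet> x b)\<^sup>2) \<le>
      m a * m b * (deriv (f a b) (dist (q a) (q b)) / dist (q a) (q b))
        * ((n \<bullet> x a - n \<bullet> x b) * (n \<bullet> x a - n \<bullet> x b))"
      by (simp add: power2_eq_square mult_ac)
  qed
  from mult_left_mono[OF this, of G] G
    work_of_forces[OF pos diff newton, where u = "\<lambda>a. n \<bullet> x a" and n = n]
  show ?thesis
    unfolding var by (simp add: mult_ac)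
qed

section \<open>The comparison with an oscillator\<close>

text \<open>
  Here \<open>\<mu> h\<^sup>2\<close> touches the least value of \<open>Q(t, \<cdot>)\<close> on unit vectors from below at \<open>t0\<close>, in the direction
  \<open>n\<close>, and \<open>h\<close> oscillates with squared frequency \<open>k\<close>, slower than the \<open>K\<close> of the forces. The test path is
  \<open>w(t) = n + (t - t0) w'\<close>, with \<open>w'\<close> chosen so that the \<open>w(t) \<bullet> x\<^sub>a(t)\<close> have vanishing derivative. A straight
  path does not stay on the unit sphere; it is admissible because the comparison inequality is homogeneous
  in \<open>w\<close>.
\<close>

lemma no_interior_minimum:
  fixes x y :: "real \<Rightarrow> nat \<Rightarrow> real ^ 'd" and z :: "nat \<Rightarrow> real ^ 'd" and h h' :: "real \<Rightarrow> real"
  assumes N: "N = CARD('d) + 1"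
    and m: "\<And>a. a \<in> {1..N} \<Longrightarrow> m a > 0"
    and t0: "\<alpha> < t0" "t0 < \<beta>"
    and dx: "\<And>t a. \<alpha> < t \<Longrightarrow> t < \<beta> \<Longrightarrow> a \<in> {1..N} \<Longrightarrow>
      ((\<lambda>s. x s a) has_vector_derivative y t a) (at t)"
    and dy: "\<And>a. a \<in> {1..N} \<Longrightarrow> ((\<lambda>s. y s a) has_vector_derivative z a) (at t0)"
    and sx: "(\<Sum>a\<in>{1..N}. m a *\<^sub>R x t0 a) = 0"
    and sy: "(\<Sum>a\<in>{1..N}. m a *\<^sub>R y t0 a) = 0"
    and momentum: "(\<Sum>a\<in>{1..N}. m a *\<^sub>R wedge (x t0 a) (y t0 a)) = 0"
    and force: "(\<Sum>a\<in>{1..N}. m a * ((n \<bullet> x t0 a) * (n \<bullet> z a))) \<le> - K * (\<Sum>a\<in>{1..N}. m a * (n \<bullet> x t0 a)\<^sup>2)"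
    and dh: "\<And>t. (h has_real_derivative h' t) (at t)"
    and dh': "(h' has_real_derivative - k * h t0) (at t0)"
    and h0: "h t0 > 0" and k: "k < K" and \<mu>: "\<mu> > 0"
    and ge: "\<And>t w. \<alpha> < t \<Longrightarrow> t < \<beta> \<Longrightarrow> \<mu> * (h t)\<^sup>2 * (w \<bullet> w) \<le> (\<Sum>a\<in>{1..N}. m a * (w \<bullet> x t a)\<^sup>2)"
    and eq: "n \<bullet> n = 1" "(\<Sum>a\<in>{1..N}. m a * (n \<bullet> x t0 a)\<^sup>2) = \<mu> * (h t0)\<^sup>2"
  shows False
proof -
  have "\<exists>w'. \<forall>a\<in>{1..N}. w' \<bullet> x t0 a = - (n \<bullet> y t0 a)"
  proof (rule nondegenerate_covector_exists[OF N m sx])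
    have "(\<Sum>a\<in>{1..N}. m a * - (n \<bullet> y t0 a)) = - (n \<bullet> (\<Sum>a\<in>{1..N}. m a *\<^sub>R y t0 a))"
      by (simp add: inner_sum_right sum_negf)
    then show "(\<Sum>a\<in>{1..N}. m a * - (n \<bullet> y t0 a)) = 0" using sy by simp
  next
    fix w :: "real ^ 'd" assume "w \<noteq> 0"
    then have "\<mu> * (h t0)\<^sup>2 * (w \<bullet> w) > 0" using \<mu> h0 by simp
    with ge[OF t0, of w] have "(\<Sum>a\<in>{1..N}. m a * (w \<bullet> x t0 a)\<^sup>2) \<noteq> 0" by linarith
    then show "\<exists>a\<in>{1..N}. w \<bullet> x t0 a \<noteq> 0" by (metis (no_types, lifting) mult_zero_right power_zero_numeral sum.neutral)
  qed
  then obtain w' where w': "\<And>a. a \<in> {1..N} \<Longrightarrow> w' \<bullet> x t0 a = - (n \<bullet> y t0 a)" by metis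
  define w where "w = (\<lambda>t. n + (t - t0) *\<^sub>R w')"
  define U where "U = (\<lambda>a t. w t \<bullet> x t a)"
  define V where "V = (\<lambda>a t. w' \<bullet> x t a + w t \<bullet> y t a)"
  define D where "D = (\<lambda>t. (\<Sum>a\<in>{1..N}. m a * (U a t)\<^sup>2) - \<mu> * (h t)\<^sup>2 * (w t \<bullet> w t))"
  define D' where "D' = (\<lambda>t. (\<Sum>a\<in>{1..N}. m a * (2 * U a t * V a t))
    - \<mu> * (2 * h t * h' t * (w t \<bullet> w t) + (h t)\<^sup>2 * (2 * (w' \<bullet> w t))))"
  define D2 where "D2 = (\<Sum>a\<in>{1..N}. m a * (2 * (V a t0 * V a t0 + U a t0 * (2 * (w' \<bullet> y t0 a) + n \<bullet> z a))))
    - \<mu> * (2 * (h' t0 * h' t0 + h t0 * (- k * h t0)) + 8 * h t0 * h' t0 * (w' \<bullet> n) + (h t0)\<^sup>2 * (2 * (w' \<bullet> w')))"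
  have dw: "(w has_vector_derivative w') (at t)" for t
    unfolding w_def by (auto intro!: derivative_eq_intros simp: has_vector_derivative_def)
  have inner_deriv: "((\<lambda>t. A t \<bullet> B t) has_real_derivative (A' \<bullet> B t + A t \<bullet> B')) (at t)"
    if "(A has_vector_derivative A') (at t)" "(B has_vector_derivative B') (at t)"
    for A B :: "real \<Rightarrow> real ^ 'd" and A' B' t
    using has_derivative_inner[OF that[unfolded has_vector_derivative_def]]
    by (auto simp: has_field_derivative_def fun_eq_iff algebra_simps elim!: has_derivative_eq_rhs)
  have dww: "((\<lambda>t. w t \<bullet> w t) has_real_derivative 2 * (w' \<bullet> w t)) (at t)" for t
    using inner_deriv[OF dw dw] by (simp add: inner_commute)
  have dww': "((\<lambda>t. w' \<bullet> w t) has_real_derivative w' \<bullet> w') (at t)" for t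
    using inner_deriv[OF has_vector_derivative_const dw, of w'] by simp
  have dU: "(U a has_real_derivative V a t) (at t)" if "\<alpha> < t" "t < \<beta>" "a \<in> {1..N}" for a t
    unfolding U_def V_def by (rule inner_deriv[OF dw dx[OF that]])
  have dV: "(V a has_real_derivative 2 * (w' \<bullet> y t0 a) + n \<bullet> z a) (at t0)" if "a \<in> {1..N}" for a
  proof -
    have "((\<lambda>t. w' \<bullet> x t a) has_real_derivative w' \<bullet> y t0 a) (at t0)"
      using inner_deriv[OF has_vector_derivative_const dx[OF t0 that], of w'] by simp
    moreover have "((\<lambda>t. w t \<bullet> y t a) has_real_derivative w' \<bullet> y t0 a + n \<bullet> z a) (at t0)"
      using inner_deriv[OF dw dy[OF that]] by (simp add: w_def)
    ultimately show ?thesis unfolding V_def by (auto intro!: derivative_eq_intros)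
  qed
  have w0: "w t0 = n" by (simp add: w_def)
  have V0: "V a t0 = 0" if "a \<in> {1..N}" for a using w'[OF that] by (simp add: V_def w0)
  have dD: "(D has_real_derivative D' t) (at t)" if "\<alpha> < t" "t < \<beta>" for t
    unfolding D_def D'_def
    by (rule derivative_eq_intros dU dww dh that refl | assumption)+
       (simp add: algebra_simps)
  have dD': "(D' has_real_derivative D2) (at t0)"
    unfolding D'_def D2_def
    by (rule derivative_eq_intros dU dV dww dww' dh dh' t0 refl | assumption)+
       (simp add: w0 algebra_simps eq power2_eq_square)
  have D0: "D t0 = 0" unfolding D_def U_def w0 eq by simp
  have Dge: "D t0 \<le> D t" if "\<alpha> < t" "t < \<beta>" for t
    unfolding D0 using ge[OF that, of "w t"] by (simp add: D_def U_def)
  note min = second_derivative_at_minimum[OF t0 dD dD' Dge]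
  define H where "H = \<mu> * (h t0)\<^sup>2"
  have H: "H > 0" using \<mu> h0 by (simp add: H_def)
  (* As the projections are stationary, D' = 0 ties the radial part of w' to h'. *)
  have "\<mu> * (2 * h t0 * h' t0 + (h t0)\<^sup>2 * (2 * (w' \<bullet> n))) = 0"
    using min(1) V0 by (simp add: D'_def w0 eq)
  then have "2 * \<mu> * h t0 * (h' t0 + h t0 * (w' \<bullet> n)) = 0" by (simp add: power2_eq_square algebra_simps)
  then have crit: "h' t0 = - h t0 * (w' \<bullet> n)" using \<mu> h0 by auto
  (* After exchanging n and w' by zero angular momentum, the choice of w' leaves minus a sum of squares. *)
  have torque: "(\<Sum>a\<in>{1..N}. m a * (U a t0 * (w' \<bullet> y t0 a))) = - (\<Sum>a\<in>{1..N}. m a * (w' \<bullet> x t0 a)\<^sup>2)"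
    using zero_momentum_symmetry[OF momentum, of n w'] w'
    by (simp add: U_def w0 sum_negf[symmetric] power2_eq_square)
  have "D2 = 4 * (\<Sum>a\<in>{1..N}. m a * (U a t0 * (w' \<bullet> y t0 a)))
      + 2 * (\<Sum>a\<in>{1..N}. m a * ((n \<bullet> x t0 a) * (n \<bullet> z a)))
      + 6 * H * (w' \<bullet> n)\<^sup>2 + 2 * k * H - 2 * H * (w' \<bullet> w')"
    using V0 unfolding D2_def crit
    by (simp add: H_def U_def w0 sum_distrib_left sum.distrib[symmetric] power2_eq_square algebra_simps)
  (* The multiples of H |w'|^2 from the torque, from the Cauchy-Schwarz bound on (w' . n)^2 and from
     the growth of |w|^2 cancel: -4 + 6 - 2 = 0. *)
  also have "\<dots> \<le> - 4 * (H * (w' \<bullet> w')) - 2 * K * H + 6 * H * (w' \<bullet> w') + 2 * k * H - 2 * H * (w' \<bullet> w')"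
  proof -
    have "(w' \<bullet> n)\<^sup>2 \<le> w' \<bullet> w'" using Cauchy_Schwarz_ineq[of w' n] eq by simp
    then have "H * (w' \<bullet> n)\<^sup>2 \<le> H * (w' \<bullet> w')" using H by simp
    moreover have "H * (w' \<bullet> w') \<le> (\<Sum>a\<in>{1..N}. m a * (w' \<bullet> x t0 a)\<^sup>2)"
      using ge[OF t0, of w'] by (simp add: H_def)
    ultimately show ?thesis using torque force eq(2) by (simp add: H_def[symmetric])
  qed
  also have "\<dots> = 2 * (k - K) * H" by (simp add: algebra_simps)
  also have "\<dots> < 0" using H k by (simp add: mult_neg_pos)
  finally show False using min(2) by simp
qed

text \<open>
  The cosine with \<open>\<theta> = \<omega>\<close> would vanish exactly at the end points. Taking \<open>\<theta>\<close> slightly smaller keeps it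
  positive on the whole closed interval, while the quotient stays larger at the end points, where \<open>Q\<close> is
  bounded below, than at the midpoint. Positivity of \<open>Q\<close> at the end points is what allows the strict
  inequality \<open>\<theta> < \<omega>\<close>.
\<close>

lemma interior_minimum_of_cosine_quotient:
  fixes Q :: "real \<Rightarrow> 'a :: metric_space \<Rightarrow> real"
  assumes \<omega>: "\<omega> > 0" and len: "\<beta> - \<alpha> = pi / \<omega>"
    and S: "compact S" "S \<noteq> {}"
    and cont: "continuous_on ({\<alpha>..\<beta>} \<times> S) (\<lambda>(t, n). Q t n)"
    and pos: "\<And>t n. t \<in> {\<alpha>..\<beta>} \<Longrightarrow> n \<in> S \<Longrightarrow> Q t n > 0"
  obtains \<theta> t0 n0 \<mu> where "0 < \<theta>" "\<theta> < \<omega>" "\<alpha> < t0" "t0 < \<beta>" "n0 \<in> S" "\<mu> > 0"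
    "cos (\<theta> * (t0 - (\<alpha> + \<beta>) / 2)) > 0"
    "Q t0 n0 = \<mu> * (cos (\<theta> * (t0 - (\<alpha> + \<beta>) / 2)))\<^sup>2"
    "\<And>t n. t \<in> {\<alpha>..\<beta>} \<Longrightarrow> n \<in> S \<Longrightarrow> \<mu> * (cos (\<theta> * (t - (\<alpha> + \<beta>) / 2)))\<^sup>2 \<le> Q t n"
proof -
  define L where "L = \<beta> - \<alpha>"
  define c where "c = (\<alpha> + \<beta>) / 2"
  have L: "L > 0" using \<omega> len by (simp add: L_def)
  have c: "c \<in> {\<alpha>..\<beta>}" "\<alpha> - c = - L / 2" "\<beta> - c = L / 2"
    using L by (auto simp: c_def L_def field_simps)
  have cpt: "compact ({\<alpha>..\<beta>} \<times> S)" by (intro compact_Times S compact_Icc)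
  have ne: "{\<alpha>..\<beta>} \<times> S \<noteq> {}" using c(1) S(2) by auto
  obtain n1 where n1: "n1 \<in> S" using S by auto
  obtain t1 m1 where t1: "t1 \<in> {\<alpha>..\<beta>}" "m1 \<in> S"
      "\<And>t n. t \<in> {\<alpha>..\<beta>} \<Longrightarrow> n \<in> S \<Longrightarrow> Q t1 m1 \<le> Q t n"
    using continuous_attains_inf[OF cpt ne cont] by fastforce
  define e where "e = Q t1 m1"
  have e: "e > 0" using pos t1 by (simp add: e_def)
  have "((\<lambda>\<theta>. Q c n1 * (cos (\<theta> * (L / 2)))\<^sup>2) \<longlongrightarrow> Q c n1 * (cos (\<omega> * (L / 2)))\<^sup>2) (at_left \<omega>)"
    by (intro tendsto_intros)
  moreover have half_period: "\<omega> * (L / 2) = pi / 2" using len \<omega> by (simp add: L_def)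
  ultimately have "((\<lambda>\<theta>. Q c n1 * (cos (\<theta> * (L / 2)))\<^sup>2) \<longlongrightarrow> 0) (at_left \<omega>)" by simp
  from order_tendstoD(2)[OF this e] eventually_at_left_real[OF \<omega>]
  have "eventually (\<lambda>\<theta>. Q c n1 * (cos (\<theta> * (L / 2)))\<^sup>2 < e \<and> \<theta> \<in> {0<..<\<omega>}) (at_left \<omega>)"
    by (rule eventually_conj)
  from eventually_happens'[OF _ this] obtain \<theta> where
    \<theta>: "Q c n1 * (cos (\<theta> * (L / 2)))\<^sup>2 < e" "0 < \<theta>" "\<theta> < \<omega>" by auto
  define h where "h = (\<lambda>t. cos (\<theta> * (t - c)))"
  have "\<theta> * (L / 2) < \<omega> * (L / 2)"
    using \<theta>(3) L by (intro mult_strict_right_mono) auto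
  then have lt: "\<theta> * (L / 2) < pi / 2" unfolding half_period .
  have h: "h t > 0" if "t \<in> {\<alpha>..\<beta>}" for t
  proof -
    have "\<bar>t - c\<bar> \<le> L / 2" using that c(2,3) unfolding abs_le_iff atLeastAtMost_iff by linarith
    then have "\<bar>\<theta> * (t - c)\<bar> \<le> \<theta> * (L / 2)" using \<theta> by (simp add: abs_mult)
    also note lt
    finally show ?thesis unfolding h_def by (intro cos_gt_zero_pi) auto
  qed
  have h_ends: "(h \<alpha>)\<^sup>2 = (cos (\<theta> * (L / 2)))\<^sup>2" "(h \<beta>)\<^sup>2 = (cos (\<theta> * (L / 2)))\<^sup>2"
    by (simp_all add: h_def c)
  have conth: "continuous_on ({\<alpha>..\<beta>} \<times> S) (\<lambda>(t, n). Q t n / (h t)\<^sup>2)"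
    using cont h unfolding case_prod_unfold h_def
    by (auto intro!: continuous_intros) (metis less_irrefl)
  obtain t0 n0 where t0: "t0 \<in> {\<alpha>..\<beta>}" "n0 \<in> S"
      "\<And>t n. t \<in> {\<alpha>..\<beta>} \<Longrightarrow> n \<in> S \<Longrightarrow> Q t0 n0 / (h t0)\<^sup>2 \<le> Q t n / (h t)\<^sup>2"
    using continuous_attains_inf[OF cpt ne conth] by fastforce
  define \<mu> where "\<mu> = Q t0 n0 / (h t0)\<^sup>2"
  have \<mu>: "\<mu> > 0" using pos[OF t0(1,2)] h[OF t0(1)] by (simp add: \<mu>_def)
  have eq: "Q t0 n0 = \<mu> * (h t0)\<^sup>2" using h[OF t0(1)] by (simp add: \<mu>_def)
  have le: "\<mu> * (h t)\<^sup>2 \<le> Q t n" if "t \<in> {\<alpha>..\<beta>}" "n \<in> S" for t n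
    using t0(3)[OF that] h[OF that(1)] by (simp add: \<mu>_def[symmetric] pos_le_divide_eq)
  have "\<mu> \<le> Q c n1" using le[OF c(1) n1] by (simp add: h_def)
  then have "\<mu> * (cos (\<theta> * (L / 2)))\<^sup>2 < Q t0 n0"
    using mult_right_mono[of \<mu> "Q c n1" "(cos (\<theta> * (L / 2)))\<^sup>2"] \<theta>(1) t1(3)[OF t0(1,2)]
    by (simp add: e_def)
  then have "t0 \<noteq> \<alpha>" "t0 \<noteq> \<beta>" using eq h_ends by auto
  then show ?thesis
    using that[of \<theta> t0 n0 \<mu>] \<theta> t0 \<mu> eq le h[OF t0(1)] by (auto simp: h_def c_def)
qed

section \<open>Degeneration instants\<close>

lemma force_ratio_antimono:
  fixes g :: "real \<Rightarrow> real"
  assumes g: "twice_cont_diff_on_pos g"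
    and g': "\<And>r. r > 0 \<Longrightarrow> deriv g r > 0" and g'': "\<And>r. r > 0 \<Longrightarrow> deriv (deriv g) r < 0"
    and r: "0 < r" "r \<le> c"
  shows "deriv g c / c \<le> deriv g r / r"
proof -
  have "deriv g c \<le> deriv g r"
  proof (rule DERIV_nonpos_imp_nonincreasing[OF r(2)])
    fix s assume "r \<le> s" "s \<le> c"
    then have "s > 0" using r by simp
    then show "\<exists>y. (deriv g has_real_derivative y) (at s) \<and> y \<le> 0"
      using g g''[of s] unfolding twice_cont_diff_on_pos_def
      by (intro exI[of _ "deriv (deriv g) s"]) (auto simp: DERIV_deriv_iff_real_differentiable)
  qed
  then show ?thesis using r g'[of c] by (intro frac_le) (auto intro: less_imp_le g')
qed

lemma barycentric_sum_zero:
  assumes "(\<Sum>a\<in>{1..N}. m a) \<noteq> 0"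
  shows "(\<Sum>a\<in>{1..N}. m a *\<^sub>R (x a - mass_average N m x)) = 0"
proof -
  have "(\<Sum>a\<in>{1..N}. m a *\<^sub>R mass_average N m x) = (\<Sum>a\<in>{1..N}. m a) *\<^sub>R mass_average N m x"
    by (simp only: scaleR_left.sum)
  also have "\<dots> = (\<Sum>a\<in>{1..N}. m a *\<^sub>R x a)" using assms by (simp add: mass_average_def)
  finally show ?thesis by (simp only: scaleR_diff_right sum_subtractf diff_self)
qed

lemma nondegenerate_inertia_pos:
  assumes nd: "\<not> degenerate N x" and m: "\<And>a. a \<in> {1..N} \<Longrightarrow> m a > 0" and w: "w \<noteq> 0"
  shows "(\<Sum>a\<in>{1..N}. m a * (w \<bullet> (x a - p))\<^sup>2) > 0"
proof -
  have "\<exists>a\<in>{1..N}. w \<bullet> x a \<noteq> w \<bullet> p"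
  proof (rule ccontr)
    assume "\<not> ?thesis"
    with w have "degenerate N x"
      unfolding degenerate_def by (intro exI[of _ w] exI[of _ "w \<bullet> p"]) auto
    with nd show False ..
  qed
  then obtain a where a: "a \<in> {1..N}" "w \<bullet> x a \<noteq> w \<bullet> p" ..
  then have "m a * (w \<bullet> (x a - p))\<^sup>2 > 0" using m by (simp add: inner_diff_right)
  with a(1) show ?thesis by (intro sum_pos2[of _ a]) (auto intro!: mult_nonneg_nonneg less_imp_le[OF m])
qed

lemma has_vector_derivative_mass_average:
  assumes "\<And>a. a \<in> {1..N} \<Longrightarrow> ((\<lambda>t. x t a) has_vector_derivative y a) F"
  shows "((\<lambda>t. mass_average N m (x t)) has_vector_derivative mass_average N m y) F"
  unfolding mass_average_def
  by (intro bounded_linear.has_vector_derivative[OF bounded_linear_scaleR_right] has_vector_derivative_sum assms)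

theorem theorem1p3:
  fixes q v :: "real \<Rightarrow> nat \<Rightarrow> real ^ 'd"
    and m :: "nat \<Rightarrow> real"
    and f :: "nat \<Rightarrow> nat \<Rightarrow> real \<Rightarrow> real"
    and G M c \<delta> :: real
    and I :: "real set"
    and N :: nat
  assumes "N = CARD('d) + 1"
    and "G > 0"
    and "\<And>a. a \<in> {1..N} \<Longrightarrow> m a > 0"
    and "M = (\<Sum>a\<in>{1..N}. m a)"
    and "\<And>a b r. a \<in> {1..N} \<Longrightarrow> b \<in> {1..N} \<Longrightarrow> a \<noteq> b \<Longrightarrow> r > 0 \<Longrightarrow> f a b r = f b a r"
    and "\<And>a b. a \<in> {1..N} \<Longrightarrow> b \<in> {1..N} \<Longrightarrow> a \<noteq> b \<Longrightarrow> twice_cont_diff_on_pos (f a b)"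
    and "\<And>a b r. a \<in> {1..N} \<Longrightarrow> b \<in> {1..N} \<Longrightarrow> a \<noteq> b \<Longrightarrow> r > 0 \<Longrightarrow> deriv (f a b) r > 0"
    and "\<And>a b r. a \<in> {1..N} \<Longrightarrow> b \<in> {1..N} \<Longrightarrow> a \<noteq> b \<Longrightarrow> r > 0 \<Longrightarrow> deriv (deriv (f a b)) r < 0"
    and "\<And>a b. a \<in> {1..N} \<Longrightarrow> b \<in> {1..N} \<Longrightarrow> a \<noteq> b \<Longrightarrow>
           ((\<lambda>r. deriv (f a b) r / r) \<longlongrightarrow> 0) at_top"
    and "is_interval I"
    and "newton_solution N G m f I q v"
    and "\<And>t. t \<in> I \<Longrightarrow> angular_momentum N m (q t) (v t) = 0"
    and "c > 0"
    and "\<And>t a b. t \<in> I \<Longrightarrow> a \<in> {1..N} \<Longrightarrow> b \<in> {1..N} \<Longrightarrow> a \<noteq> b \<Longrightarrow> dist (q t a) (q t b) \<le> c"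
    and "\<delta> = Min {deriv (f a b) c / c | a b. a \<in> {1..N} \<and> b \<in> {1..N} \<and> a \<noteq> b}"
  shows "\<delta> > 0 \<and>
    (\<forall>\<alpha> \<beta>. \<beta> - \<alpha> = pi * (G * M * \<delta>) powr (- 1 / 2) \<and> {\<alpha>..\<beta>} \<subseteq> I \<longrightarrow>
       (\<exists>t\<in>{\<alpha>..\<beta>}. degenerate N (q t)))"
proof -
  note N = assms(1) and G = assms(2) and m = assms(3) and M = assms(4)
    and smooth = assms(6) and f' = assms(7) and f'' = assms(8)
    and sol = assms(11) and momentum = assms(12) and c = assms(13) and bound = assms(14)
  have M_pos: "(\<Sum>a\<in>{1..N}. m a) > 0"
    using N by (intro sum_pos m) auto
  let ?R = "{deriv (f a b) c / c | a b. a \<in> {1..N} \<and> b \<in> {1..N} \<and> a \<noteq> b}"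
  have "?R \<subseteq> (\<lambda>(a, b). deriv (f a b) c / c) ` ({1..N} \<times> {1..N})" by auto
  then have fin: "finite ?R" by (rule finite_subset) auto
  have "1 \<in> {1..N}" "N \<in> {1..N}" "1 \<noteq> N" using N by auto
  then have ne: "?R \<noteq> {}" by blast
  have "\<delta> > 0" unfolding assms(15) using fin ne c f' by auto
  have \<delta>_le: "\<delta> \<le> deriv (f a b) r / r"
    if "a \<in> {1..N}" "b \<in> {1..N}" "a \<noteq> b" "0 < r" "r \<le> c" for a b r
  proof -
    have "\<delta> \<le> deriv (f a b) c / c" unfolding assms(15) using that by (intro Min_le fin) blast
    also have "\<dots> \<le> deriv (f a b) r / r"
      using that by (intro force_ratio_antimono smooth f' f'') auto
    finally show ?thesis .
  qed
  define \<omega> where "\<omega> = sqrt (G * M * \<delta>)"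
  have \<omega>: "\<omega> > 0" "\<omega>\<^sup>2 = G * M * \<delta>" using G M_pos M \<open>\<delta> > 0\<close> by (auto simp: \<omega>_def)
  have "X powr (- 1 / 2) = 1 / sqrt X" if "X > 0" for X :: real
    using that powr_minus_divide[of X "1 / 2"] powr_half_sqrt[of X] by simp
  moreover have "G * M * \<delta> > 0" using G M_pos M \<open>\<delta> > 0\<close> by simp
  ultimately have period: "pi * (G * M * \<delta>) powr (- 1 / 2) = pi / \<omega>" by (simp add: \<omega>_def)
  have "\<exists>t\<in>{\<alpha>..\<beta>}. degenerate N (q t)" if len: "\<beta> - \<alpha> = pi / \<omega>" and sub: "{\<alpha>..\<beta>} \<subseteq> I" for \<alpha> \<beta>
  proof (rule ccontr)
    assume "\<not> (\<exists>t\<in>{\<alpha>..\<beta>}. degenerate N (q t))"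
    then have nd: "\<And>t. t \<in> {\<alpha>..\<beta>} \<Longrightarrow> \<not> degenerate N (q t)" by auto
    define x where "x = (\<lambda>t a. q t a - mass_average N m (q t))"
    define y where "y = (\<lambda>t a. v t a - mass_average N m (v t))"
    define Q where "Q = (\<lambda>t w. \<Sum>a\<in>{1..N}. m a * (w \<bullet> x t a)\<^sup>2)"
    have dq: "((\<lambda>s. q s a) has_vector_derivative v t a) (at t within {\<alpha>..\<beta>})"
      if "t \<in> {\<alpha>..\<beta>}" "a \<in> {1..N}" for t a
      using sol that sub unfolding newton_solution_def
      by (meson has_vector_derivative_within_subset subsetD)
    have dx: "((\<lambda>s. x s a) has_vector_derivative y t a) (at t within {\<alpha>..\<beta>})"
      if "t \<in> {\<alpha>..\<beta>}" "a \<in> {1..N}" for t a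
      unfolding x_def y_def
      by (intro has_vector_derivative_diff has_vector_derivative_mass_average dq that)
    have contx: "continuous_on {\<alpha>..\<beta>} (\<lambda>t. x t a)" if "a \<in> {1..N}" for a
      using dx[OF _ that] by (rule continuous_on_vector_derivative)
    have contQ: "continuous_on ({\<alpha>..\<beta>} \<times> sphere 0 1) (\<lambda>(t, n). Q t n)"
      unfolding Q_def case_prod_unfold
      by (intro continuous_intros continuous_on_compose2[OF contx]) auto
    have Qpos: "Q t n > 0" if "t \<in> {\<alpha>..\<beta>}" "n \<noteq> 0" for t n
      unfolding Q_def x_def using nd[OF that(1)] m that(2) by (rule nondegenerate_inertia_pos)
    have sphere: "sphere (0 :: real ^ 'd) 1 \<noteq> {}" by (metis sphere_eq_empty less_numeral_extra(1) not_one_less_zero)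
    obtain \<theta> t0 n0 \<mu> where min: "0 < \<theta>" "\<theta> < \<omega>" "\<alpha> < t0" "t0 < \<beta>" "n0 \<in> sphere 0 1" "\<mu> > 0"
      "cos (\<theta> * (t0 - (\<alpha> + \<beta>) / 2)) > 0"
      "Q t0 n0 = \<mu> * (cos (\<theta> * (t0 - (\<alpha> + \<beta>) / 2)))\<^sup>2"
      "\<And>t n. t \<in> {\<alpha>..\<beta>} \<Longrightarrow> n \<in> sphere 0 1 \<Longrightarrow> \<mu> * (cos (\<theta> * (t - (\<alpha> + \<beta>) / 2)))\<^sup>2 \<le> Q t n"
      using interior_minimum_of_cosine_quotient[OF \<omega>(1) len compact_sphere sphere contQ]
      by (metis (no_types, lifting) Qpos mem_sphere_0 norm_zero zero_neq_one)
    define h where "h = (\<lambda>t. cos (\<theta> * (t - (\<alpha> + \<beta>) / 2)))"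
    define h' where "h' = (\<lambda>t. - \<theta> * sin (\<theta> * (t - (\<alpha> + \<beta>) / 2)))"
    have t0I: "t0 \<in> I" using sub min(3,4) by auto
    have at: "at t within {\<alpha>..\<beta>} = at t" if "\<alpha> < t" "t < \<beta>" for t
      using that by (simp add: at_within_Icc_at)
    have "\<exists>acc. \<forall>a\<in>{1..N}. ((\<lambda>s. v s a) has_vector_derivative acc a) (at t0 within I) \<and>
        GDERIV (\<lambda>x. potential N G m f ((q t0)(a := x))) (q t0 a) :> - (m a *\<^sub>R acc a)"
      using sol t0I unfolding newton_solution_def by (intro bchoice) blast
    then obtain acc where acc: "\<And>a. a \<in> {1..N} \<Longrightarrow> ((\<lambda>s. v s a) has_vector_derivative acc a) (at t0 within I)"
      "\<And>a. a \<in> {1..N} \<Longrightarrow> GDERIV (\<lambda>x. potential N G m f ((q t0)(a := x))) (q t0 a) :> - (m a *\<^sub>R acc a)"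
      by blast
    have dv: "((\<lambda>s. v s a) has_vector_derivative acc a) (at t0)" if "a \<in> {1..N}" for a
      using has_vector_derivative_within_subset[OF acc(1)[OF that] sub] at[OF min(3,4)] by simp
    define z where "z = (\<lambda>a. acc a - mass_average N m acc)"
    have dist_pos: "dist (q t0 a) (q t0 b) > 0" if "a \<in> {1..N}" "b \<in> {1..N}" "a \<noteq> b" for a b
      using sol t0I that unfolding newton_solution_def by blast
    have sx: "(\<Sum>a\<in>{1..N}. m a *\<^sub>R x t0 a) = 0" and sy: "(\<Sum>a\<in>{1..N}. m a *\<^sub>R y t0 a) = 0"
      unfolding x_def y_def using M_pos by (intro barycentric_sum_zero; simp)+
    have "(\<Sum>a\<in>{1..N}. m a * ((n0 \<bullet> x t0 a) * (n0 \<bullet> acc a))) \<le> - \<omega>\<^sup>2 * Q t0 n0"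
      unfolding \<omega>(2) M Q_def
    proof (rule restoring_force[OF G m _ _ acc(2) _ _ sx])
      fix a b assume ab: "a \<in> {1..N}" "b \<in> {1..N}" "a \<noteq> b"
      show "q t0 a \<noteq> q t0 b" using dist_pos[OF ab] by auto
      show "f a b differentiable (at (dist (q t0 a) (q t0 b)))"
        using smooth[OF ab] dist_pos[OF ab] unfolding twice_cont_diff_on_pos_def by blast
      show "\<delta> \<le> deriv (f a b) (dist (q t0 a) (q t0 b)) / dist (q t0 a) (q t0 b)"
        by (rule \<delta>_le[OF ab dist_pos[OF ab] bound[OF t0I ab]])
    qed (auto simp: x_def)
    (* The acceleration of the centre of mass drops out, because the weighted sum of the x a is zero. *)
    moreover have "(\<Sum>a\<in>{1..N}. m a * ((n0 \<bullet> x t0 a) * (n0 \<bullet> z a)))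
        = (\<Sum>a\<in>{1..N}. m a * ((n0 \<bullet> x t0 a) * (n0 \<bullet> acc a)))
          - (n0 \<bullet> (\<Sum>a\<in>{1..N}. m a *\<^sub>R x t0 a)) * (n0 \<bullet> mass_average N m acc)"
      by (simp add: z_def inner_diff_right inner_sum_right sum_distrib_left sum_subtractf algebra_simps)
    ultimately have force: "(\<Sum>a\<in>{1..N}. m a * ((n0 \<bullet> x t0 a) * (n0 \<bullet> z a))) \<le> - \<omega>\<^sup>2 * Q t0 n0"
      using sx by simp
    show False
    proof (rule no_interior_minimum[where x = x and y = y and z = z and h = h and h' = h'
          and k = "\<theta>\<^sup>2" and K = "\<omega>\<^sup>2" and \<mu> = \<mu> and n = n0, OF N m min(3,4)])
      show "((\<lambda>s. x s a) has_vector_derivative y t a) (at t)"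
        if "\<alpha> < t" "t < \<beta>" "a \<in> {1..N}" for t a
        using dx[of t a] that at by simp
      show "((\<lambda>s. y s a) has_vector_derivative z a) (at t0)" if "a \<in> {1..N}" for a
        unfolding y_def z_def
        by (intro has_vector_derivative_diff has_vector_derivative_mass_average dv that)
      show "(\<Sum>a\<in>{1..N}. m a *\<^sub>R wedge (x t0 a) (y t0 a)) = 0"
        using momentum[OF t0I] by (simp add: angular_momentum_def x_def y_def)
      show "(h has_real_derivative h' t) (at t)" for t
        unfolding h_def h'_def by (auto intro!: derivative_eq_intros)
      show "(h' has_real_derivative - \<theta>\<^sup>2 * h t0) (at t0)"
        unfolding h_def h'_def by (auto intro!: derivative_eq_intros simp: power2_eq_square)
      show "\<theta>\<^sup>2 < \<omega>\<^sup>2" using min(1,2) by (intro power_strict_mono) auto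
      show "n0 \<bullet> n0 = 1" using min(5) by (simp add: norm_eq_1)
      show "\<mu> * (h t)\<^sup>2 * (w \<bullet> w) \<le> (\<Sum>a\<in>{1..N}. m a * (w \<bullet> x t a)\<^sup>2)"
        if "\<alpha> < t" "t < \<beta>" for t w
      proof (cases "w = 0")
        case False
        have "\<mu> * (h t)\<^sup>2 \<le> Q t (w /\<^sub>R norm w)"
          using min(9)[of t "w /\<^sub>R norm w"] that False by (simp add: h_def)
        also have "\<dots> = Q t w / (w \<bullet> w)"
          unfolding Q_def sum_divide_distrib using False
          by (intro sum.cong) (auto simp: power_mult_distrib power_inverse dot_square_norm divide_inverse)
        finally show ?thesis using False by (simp add: Q_def pos_le_divide_eq)
      qed simp
    qed (use sx sy force min in \<open>simp_all add: h_def Q_def\<close>)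
  qed
  then show ?thesis using \<open>\<delta> > 0\<close> period by simp
qed

end
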